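(* Let $S$ be a Noetherian semiring and let $X_1,\ldots,X_n$ be $n\ge 1$ indeterminates over $S$. Then the following statements are equivalent: (1) $S[[X_1,X_2,\ldots,X_n]]$ is a weak content $S$-semialgebra; (2) $\sqrt{I}$ is subtractive for each ideal $I$ of $S$; (3) each prime ideal $P$ of $S$ is subtractive.
   Context: A semiring $(S,+,\cdot,0,1)$ is commutative: $(S,+,0)$ and $(S,\cdot,1)$ are commutative monoids, $1\neq 0$, multiplication distributes over addition, and $s\cdot 0=0$ for all $s$. An ideal is a nonempty subset closed under addition and under multiplication by elements of $S$. $S$ is Noetherian if every ideal of $S$ is finitely generated. A prime ideal is an ideal $P\neq S$ such that $ab\in P$ implies $a\in P$ or $b\in P$. An ideal $I$ is subtractive if for all $a,b\in S$, $a+b\in I$ and $a\in I$ imply $b\in I$. $\sqrt{I}=\{s\in S: s^n\in I\text{ for some positive integer }n\}$. An $S$-semialgebra is a semiring $B$ with a semiring homomorphism $\lambda:S\to B$ (preserving $+,\cdot,0,1$), and scalar product $sf=\lambda(s)f$; for an ideal $I$ of $S$, $IB=\{\sum_{i=1}^n a_if_i:a_i\in I,f_i\in B\}$. For $f\in B$ let $c(f)=\bigcap\{I: I\text{ an ideal of }S,\ f\in IB\}$. $B$ is a content $S$-semimodule if $f\in c(f)B$ for all $f\in B$. $B$ is a weak content $S$-semialgebra if it is a content $S$-semimodule and $c(f)c(g)\subseteq\sqrt{c(fg)}$ for all $f,g\in B$. $S[[X_1,\ldots,X_n]]$ is the formal power series semiring, an $S$-semialgebra in the obvious way. *)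

theory Defs
  imports Complex_Main "HOL-Library.FuncSet"
begin

section \<open>Ideals of commutative semirings\<close>

definition semiring_ideal :: "'a::comm_semiring_1 set \<Rightarrow> bool" where
  "semiring_ideal I \<longleftrightarrow>
     I \<noteq> {} \<and> (\<forall>a\<in>I. \<forall>b\<in>I. a + b \<in> I) \<and> (\<forall>s. \<forall>a\<in>I. s * a \<in> I)"

definition noetherian_semiring :: "'a::comm_semiring_1 itself \<Rightarrow> bool" where
  "noetherian_semiring _ \<longleftrightarrow>
     (\<forall>I::'a set. semiring_ideal I \<longrightarrow> (\<exists>F. finite F \<and> I = semiring_ideal hull F))"

definition prime_semiring_ideal :: "'a::comm_semiring_1 set \<Rightarrow> bool" where
  "prime_semiring_ideal P \<longleftrightarrow>
     semiring_ideal P \<and> P \<noteq> UNIV \<and> (\<forall>a b. a * b \<in> P \<longrightarrow> a \<in> P \<or> b \<in> P)"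

definition subtractive_ideal :: "'a::comm_semiring_1 set \<Rightarrow> bool" where
  "subtractive_ideal I \<longleftrightarrow>
     semiring_ideal I \<and> (\<forall>a b. a + b \<in> I \<longrightarrow> a \<in> I \<longrightarrow> b \<in> I)"

definition radical :: "'a::comm_semiring_1 set \<Rightarrow> 'a set" where
  "radical I = {s. \<exists>n>0. s ^ n \<in> I}"

definition ideal_product :: "'a::comm_semiring_1 set \<Rightarrow> 'a set \<Rightarrow> 'a set" where
  "ideal_product I J =
     {(\<Sum>i<n. a i * b i) | (n::nat) a b. (\<forall>i<n. a i \<in> I) \<and> (\<forall>i<n. b i \<in> J)}"

section \<open>Semialgebras and content\<close>

text \<open>A semialgebra over \<open>'a\<close> is given by its structure homomorphism
  \<open>h :: 'a \<Rightarrow> 'b\<close>; the scalar product of \<open>s\<close> and \<open>f\<close> is \<open>h s * f\<close>.\<close>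

definition semialgebra :: "('a::comm_semiring_1 \<Rightarrow> 'b::comm_semiring_1) \<Rightarrow> bool" where
  "semialgebra h \<longleftrightarrow>
     h 0 = 0 \<and> h 1 = 1 \<and>
     (\<forall>x y. h (x + y) = h x + h y) \<and> (\<forall>x y. h (x * y) = h x * h y)"

text \<open>The set \<open>I B\<close>.\<close>

definition ideal_extension ::
    "('a::comm_semiring_1 \<Rightarrow> 'b::comm_semiring_1) \<Rightarrow> 'a set \<Rightarrow> 'b set" where
  "ideal_extension h I =
     {(\<Sum>i<n. h (a i) * f i) | (n::nat) a f. \<forall>i<n. a i \<in> I}"

definition content ::
    "('a::comm_semiring_1 \<Rightarrow> 'b::comm_semiring_1) \<Rightarrow> 'b \<Rightarrow> 'a set" where
  "content h f = \<Inter> {I. semiring_ideal I \<and> f \<in> ideal_extension h I}"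

definition content_semimodule ::
    "('a::comm_semiring_1 \<Rightarrow> 'b::comm_semiring_1) \<Rightarrow> bool" where
  "content_semimodule h \<longleftrightarrow> (\<forall>f. f \<in> ideal_extension h (content h f))"

definition weak_content_semialgebra ::
    "('a::comm_semiring_1 \<Rightarrow> 'b::comm_semiring_1) \<Rightarrow> bool" where
  "weak_content_semialgebra h \<longleftrightarrow>
     semialgebra h \<and> content_semimodule h \<and>
     (\<forall>f g. ideal_product (content h f) (content h g) \<subseteq> radical (content h (f * g)))"

section \<open>Formal power series in finitely many indeterminates\<close>

text \<open>The indeterminates are indexed by the type \<open>'n\<close>, to be instantiated in class
  \<open>finite\<close>; a monomial is its exponent vector \<open>'n \<Rightarrow> nat\<close>.\<close>

typedef ('a, 'n) mfps = "UNIV :: (('n \<Rightarrow> nat) \<Rightarrow> 'a) set"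
  morphisms mfps_nth Abs_mfps
  by simp

setup_lifting type_definition_mfps

definition exponent_splits :: "('n \<Rightarrow> nat) \<Rightarrow> (('n \<Rightarrow> nat) \<times> ('n \<Rightarrow> nat)) set" where
  "exponent_splits m = {(k, l). \<forall>i. k i + l i = m i}"

lemma finite_exponent_splits [simp]:
  fixes m :: "'n::finite \<Rightarrow> nat"
  shows "finite (exponent_splits m)"
proof -
  have "finite (PiE (UNIV::'n set) (\<lambda>i. {..m i}))"
    by (intro finite_PiE) auto
  then have fin: "finite {k. \<forall>i. k i \<le> m i}"
    by (rule rev_finite_subset) (auto simp: PiE_def)
  have "exponent_splits m \<subseteq> {k. \<forall>i. k i \<le> m i} \<times> {k. \<forall>i. k i \<le> m i}"
    by (auto simp: exponent_splits_def) (metis le_add1, metis le_add2)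
  then show ?thesis
    using fin by (meson finite_SigmaI finite_subset)
qed

instantiation mfps :: (comm_semiring_1, finite) comm_semiring_1
begin

lift_definition zero_mfps :: "('a, 'b) mfps" is "\<lambda>_. 0" .

lift_definition one_mfps :: "('a, 'b) mfps" is "\<lambda>m. if m = (\<lambda>_. 0) then 1 else 0" .

lift_definition plus_mfps :: "('a, 'b) mfps \<Rightarrow> ('a, 'b) mfps \<Rightarrow> ('a, 'b) mfps"
  is "\<lambda>f g m. f m + g m" .

lift_definition times_mfps :: "('a, 'b) mfps \<Rightarrow> ('a, 'b) mfps \<Rightarrow> ('a, 'b) mfps"
  is "\<lambda>f g m. \<Sum>(k, l)\<in>exponent_splits m. f k * g l" .

instance
proof
  fix f g h :: "('a, 'b) mfps"
  show "f + g + h = f + (g + h)"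
    by transfer (simp add: add.assoc)
  show "f + g = g + f"
    by transfer (simp add: add.commute)
  show "0 + f = f"
    by transfer simp
  show "0 * f = 0"
    by transfer (simp add: case_prod_unfold)
  show "f * 0 = 0"
    by transfer (simp add: case_prod_unfold)
  show "(0::('a, 'b) mfps) \<noteq> 1"
    by transfer (metis zero_neq_one)
  show "(f + g) * h = f * h + g * h"
    by transfer (simp add: case_prod_unfold distrib_right sum.distrib)
  show "1 * f = f"
  proof (transfer, rule ext)
    fix f :: "('b \<Rightarrow> nat) \<Rightarrow> 'a" and m :: "'b \<Rightarrow> nat"
    have "(\<Sum>(k, l)\<in>exponent_splits m. (if k = (\<lambda>_. 0) then 1 else 0) * f l)
        = (\<Sum>(k, l)\<in>{(\<lambda>_::'b. 0::nat, m)}. (if k = (\<lambda>_. 0) then 1 else 0) * f l)"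
      by (intro sum.mono_neutral_right finite_exponent_splits)
        (auto simp: exponent_splits_def fun_eq_iff split: if_splits)
    then show "(\<Sum>(k, l)\<in>exponent_splits m. (if k = (\<lambda>_. 0) then 1 else 0) * f l) = f m"
      by simp
  qed
  show "f * g = g * f"
  proof (transfer, rule ext)
    fix f g :: "('b \<Rightarrow> nat) \<Rightarrow> 'a" and m :: "'b \<Rightarrow> nat"
    show "(\<Sum>(k, l)\<in>exponent_splits m. f k * g l) = (\<Sum>(k, l)\<in>exponent_splits m. g k * f l)"
      by (rule sum.reindex_bij_witness[of _ prod.swap prod.swap])
        (auto simp: exponent_splits_def add.commute mult.commute)
  qed
  show "f * g * h = f * (g * h)"
  proof (transfer, rule ext)
    fix f g h :: "('b \<Rightarrow> nat) \<Rightarrow> 'a" and m :: "'b \<Rightarrow> nat"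
    have "(\<Sum>(p, l)\<in>exponent_splits m. (\<Sum>(j, k)\<in>exponent_splits p. f j * g k) * h l)
        = (\<Sum>x\<in>(SIGMA x:exponent_splits m. exponent_splits (fst x)).
             f (fst (snd x)) * g (snd (snd x)) * h (snd (fst x)))"
      by (simp add: case_prod_unfold sum_distrib_right sum.Sigma)
    also have "\<dots> = (\<Sum>x\<in>(SIGMA x:exponent_splits m. exponent_splits (snd x)).
             f (fst (fst x)) * (g (fst (snd x)) * h (snd (snd x))))"
      by (rule sum.reindex_bij_witness[of _
            "\<lambda>x. ((\<lambda>i. fst (fst x) i + fst (snd x) i, snd (snd x)), (fst (fst x), fst (snd x)))"
            "\<lambda>x. ((fst (snd x), \<lambda>i. snd (snd x) i + snd (fst x) i), (snd (snd x), snd (fst x)))"])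
        (auto simp: exponent_splits_def fun_eq_iff mult.assoc, (metis add.assoc)+)
    also have "\<dots> = (\<Sum>(j, p)\<in>exponent_splits m. f j * (\<Sum>(k, l)\<in>exponent_splits p. g k * h l))"
      by (simp add: case_prod_unfold sum_distrib_left sum.Sigma)
    finally show "(\<Sum>(p, l)\<in>exponent_splits m. (\<Sum>(j, k)\<in>exponent_splits p. f j * g k) * h l)
        = (\<Sum>(j, p)\<in>exponent_splits m. f j * (\<Sum>(k, l)\<in>exponent_splits p. g k * h l))" .
  qed
qed

end

lift_definition mfps_const :: "'a::comm_semiring_1 \<Rightarrow> ('a, 'n::finite) mfps"
  is "\<lambda>c m. if m = (\<lambda>_. 0) then c else 0" .

lemma semialgebra_mfps_const:
  "semialgebra (mfps_const :: 'a::comm_semiring_1 \<Rightarrow> ('a, 'n::finite) mfps)"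
  unfolding semialgebra_def
proof (intro conjI allI)
  show "mfps_const 0 = (0 :: ('a, 'n) mfps)"
    by transfer (simp add: fun_eq_iff)
  show "mfps_const 1 = (1 :: ('a, 'n) mfps)"
    by transfer simp
  fix x y :: 'a
  show "mfps_const (x + y) = (mfps_const x + mfps_const y :: ('a, 'n) mfps)"
    by transfer (simp add: fun_eq_iff)
  show "mfps_const (x * y) = (mfps_const x * mfps_const y :: ('a, 'n) mfps)"
  proof (transfer, rule ext)
    fix x y :: 'a and m :: "'n \<Rightarrow> nat"
    have "(\<Sum>(k, l)\<in>exponent_splits m.
            (if k = (\<lambda>_. 0) then x else 0) * (if l = (\<lambda>_. 0) then y else 0))
        = (\<Sum>(k, l)\<in>{(\<lambda>_::'n. 0::nat, m)}.
            (if k = (\<lambda>_. 0) then x else 0) * (if l = (\<lambda>_. 0) then y else 0))"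
      by (intro sum.mono_neutral_right finite_exponent_splits)
        (auto simp: exponent_splits_def fun_eq_iff split: if_splits)
    then show "(if m = (\<lambda>_. 0) then x * y else 0) = (\<Sum>(k, l)\<in>exponent_splits m.
            (if k = (\<lambda>_. 0) then x else 0) * (if l = (\<lambda>_. 0) then y else 0))"
      by simp
  qed
qed

end

theory Submission imports Defs
begin

text \<open>
  Over a Noetherian semiring a power series lies in the extension of an ideal \<open>I\<close> exactly when all
  its coefficients lie in \<open>I\<close> (\<open>ideal_extension_mfps_iff\<close>), since finitely many generators of \<open>I\<close>
  can be factored out of all coefficients simultaneously.  Hence the content of \<open>f\<close> is the ideal
  generated by the coefficients of \<open>f\<close>, the series form a content semimodule, and being a weak
  content semialgebra is a statement about ideals that contain all coefficients of a product.  By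
  Krull's description of the radical as an intersection of primes (\<open>radical_eq_Inter_primes\<close>), only
  prime ideals \<open>P\<close> matter.

  If \<open>P\<close> is a subtractive prime, then the series with coefficients in \<open>P\<close> form a prime ideal, by
  Gauss's argument: if \<open>f\<close> and \<open>g\<close> have coefficients outside \<open>P\<close>, two of them can be chosen such that
  their product is the only term outside \<open>P\<close> in some coefficient of \<open>f * g\<close>, and subtractivity
  cancels the other terms (\<open>coefficients_of_product_in_subtractive_prime\<close>).

  Conversely, let \<open>P\<close> be prime with \<open>a\<close> and \<open>a + b\<close> in \<open>P\<close>.  The product of \<open>a + b X\<close> and
  \<open>b + (a + b) X\<close> is \<open>a b + (a\<^sup>2 + b (a + b)) X + b (a + b) X\<^sup>2\<close>, with all coefficients in \<open>P\<close>, while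
  \<open>b\<close> belongs to both contents.  The weak content property puts a power of \<open>b\<^sup>2\<close> into \<open>P\<close>, so
  \<open>b \<in> P\<close>.

  Finally, primes are their own radicals, and radicals are intersections of primes; so subtractivity
  of all radicals and subtractivity of all primes amount to the same.
\<close>

section \<open>Ideals and radicals\<close>

lemma semiring_ideal_zero: "semiring_ideal I \<Longrightarrow> 0 \<in> I"
  unfolding semiring_ideal_def by (metis ex_in_conv mult_zero_left)

lemma semiring_ideal_add: "semiring_ideal I \<Longrightarrow> a \<in> I \<Longrightarrow> b \<in> I \<Longrightarrow> a + b \<in> I"
  by (simp add: semiring_ideal_def)

lemma semiring_ideal_mult_left: "semiring_ideal I \<Longrightarrow> a \<in> I \<Longrightarrow> s * a \<in> I"
  by (simp add: semiring_ideal_def)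

lemma semiring_ideal_mult_right: "semiring_ideal I \<Longrightarrow> a \<in> I \<Longrightarrow> a * s \<in> I"
  by (metis mult.commute semiring_ideal_mult_left)

lemma semiring_ideal_sum:
  assumes "semiring_ideal I" "\<And>x. x \<in> A \<Longrightarrow> f x \<in> I"
  shows "sum f A \<in> I"
  using assms(2)
  by (induction A rule: infinite_finite_induct)
    (auto intro: semiring_ideal_zero semiring_ideal_add assms(1))

lemma semiring_ideal_Inter:
  assumes "\<And>I. I \<in> \<I> \<Longrightarrow> semiring_ideal I"
  shows "semiring_ideal (\<Inter>\<I>)"
  unfolding semiring_ideal_def
proof (intro conjI)
  show "\<Inter>\<I> \<noteq> {}"
    using assms semiring_ideal_zero by fastforce
qed (use assms in \<open>auto intro: semiring_ideal_add semiring_ideal_mult_left\<close>)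

lemma subtractive_ideal_Inter:
  assumes "\<And>I. I \<in> \<I> \<Longrightarrow> subtractive_ideal I"
  shows "subtractive_ideal (\<Inter>\<I>)"
  using assms semiring_ideal_Inter[of \<I>] unfolding subtractive_ideal_def by blast

lemma semiring_ideal_adjoin:
  assumes "semiring_ideal I"
  shows "semiring_ideal {x + r * a | x r. x \<in> I}"
  unfolding semiring_ideal_def
proof (intro conjI ballI allI)
  show "{x + r * a | x r. x \<in> I} \<noteq> {}"
    using semiring_ideal_zero[OF assms] by blast
next
  fix u v assume "u \<in> {x + r * a | x r. x \<in> I}" "v \<in> {x + r * a | x r. x \<in> I}"
  then obtain x r y t where "u = x + r * a" "v = y + t * a" and xy: "x \<in> I" "y \<in> I" by blast
  then have "u + v = (x + y) + (r + t) * a" by (simp add: algebra_simps)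
  with semiring_ideal_add[OF assms xy] show "u + v \<in> {x + r * a | x r. x \<in> I}" by blast
next
  fix s u assume "u \<in> {x + r * a | x r. x \<in> I}"
  then obtain x r where "u = x + r * a" and x: "x \<in> I" by blast
  then have "s * u = s * x + (s * r) * a" by (simp add: algebra_simps)
  with semiring_ideal_mult_left[OF assms x] show "s * u \<in> {x + r * a | x r. x \<in> I}" by blast
qed

lemma prime_semiring_ideal_power:
  assumes "prime_semiring_ideal P" "s ^ n \<in> P"
  shows "s \<in> P"
  using assms(2)
proof (induction n)
  case 0
  then have "r \<in> P" for r
    using assms(1) semiring_ideal_mult_left[of P 1 r] by (simp add: prime_semiring_ideal_def)
  then show ?case .
next
  case (Suc n)
  then show ?case using assms(1) by (auto simp: prime_semiring_ideal_def)
qed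

lemma radical_mono: "I \<subseteq> J \<Longrightarrow> radical I \<subseteq> radical J"
  by (auto simp: radical_def)

lemma radical_prime: "prime_semiring_ideal P \<Longrightarrow> radical P = P"
proof
  assume "prime_semiring_ideal P"
  then show "radical P \<subseteq> P" by (auto simp: radical_def intro: prime_semiring_ideal_power)
  show "P \<subseteq> radical P" by (auto simp: radical_def intro!: exI[of _ 1])
qed

text \<open>Krull's lemma: an ideal that is maximal among those containing \<open>I\<close> and no power of \<open>s\<close> is
  prime, because adjoining either of two outside elements captures a power of \<open>s\<close>, and the
  product of these two powers lies in the ideal as soon as the product of the elements does.\<close>

lemma prime_avoiding_powers:
  assumes I: "semiring_ideal I" and s: "s \<notin> radical I"
  obtains P where "prime_semiring_ideal P" "I \<subseteq> P" "s \<notin> P"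
proof -
  define \<A> where "\<A> = {J. semiring_ideal J \<and> I \<subseteq> J \<and> s \<notin> radical J}"
  have "\<exists>M\<in>\<A>. \<forall>J\<in>\<A>. M \<subseteq> J \<longrightarrow> J = M"
  proof (rule subset_Zorn_nonempty)
    show "\<A> \<noteq> {}" using I s by (auto simp: \<A>_def)
  next
    fix \<C> assume ne: "\<C> \<noteq> {}" and chain: "subset.chain \<A> \<C>"
    then have sub: "\<C> \<subseteq> \<A>" by (simp add: subset_chain_def)
    have "semiring_ideal (\<Union>\<C>)"
      unfolding semiring_ideal_def
    proof (intro conjI ballI allI)
      show "\<Union>\<C> \<noteq> {}" using ne sub by (force simp: \<A>_def dest: semiring_ideal_zero)
    next
      fix a b assume "a \<in> \<Union>\<C>" "b \<in> \<Union>\<C>"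
      then obtain J K where JK: "J \<in> \<C>" "K \<in> \<C>" and ab: "a \<in> J" "b \<in> K" by blast
      with chain have "J \<subseteq> K \<or> K \<subseteq> J" by (auto simp: subset_chain_def)
      with JK ab obtain L where "L \<in> \<C>" "a \<in> L" "b \<in> L" by blast
      moreover from this sub have "semiring_ideal L" by (auto simp: \<A>_def)
      ultimately show "a + b \<in> \<Union>\<C>" by (blast intro: semiring_ideal_add)
    next
      fix r a assume "a \<in> \<Union>\<C>"
      then obtain L where "L \<in> \<C>" "a \<in> L" by blast
      moreover from this sub have "semiring_ideal L" by (auto simp: \<A>_def)
      ultimately show "r * a \<in> \<Union>\<C>" by (blast intro: semiring_ideal_mult_left)
    qed
    moreover have "s \<notin> radical (\<Union>\<C>)"
    proof
      assume "s \<in> radical (\<Union>\<C>)"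
      then obtain J where "J \<in> \<C>" "s \<in> radical J" by (auto simp: radical_def)
      with sub show False by (auto simp: \<A>_def)
    qed
    moreover have "I \<subseteq> \<Union>\<C>" using ne sub by (auto simp: \<A>_def)
    ultimately show "\<Union>\<C> \<in> \<A>" by (simp add: \<A>_def)
  qed
  then obtain M where M: "M \<in> \<A>" and max: "\<And>J. J \<in> \<A> \<Longrightarrow> M \<subseteq> J \<Longrightarrow> J = M" by blast
  then have idM: "semiring_ideal M" and IM: "I \<subseteq> M" and sM: "s \<notin> radical M"
    by (auto simp: \<A>_def)
  have capture: "\<exists>n>0. \<exists>x\<in>M. \<exists>r. s ^ n = x + r * a" if a: "a \<notin> M" for a
  proof -
    let ?J = "{x + r * a | x r. x \<in> M}"
    have "M \<subseteq> ?J"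
    proof
      fix x assume "x \<in> M"
      moreover have "x = x + 0 * a" by simp
      ultimately show "x \<in> ?J" by blast
    qed
    moreover have "a \<in> ?J"
    proof -
      have "a = 0 + 1 * a" by simp
      with semiring_ideal_zero[OF idM] show ?thesis by blast
    qed
    ultimately have "?J \<notin> \<A>" using a max by blast
    with \<open>M \<subseteq> ?J\<close> IM semiring_ideal_adjoin[OF idM] have "s \<in> radical ?J"
      by (auto simp: \<A>_def)
    then show ?thesis by (auto simp: radical_def)
  qed
  have s_out: "s \<notin> M" using sM by (auto simp: radical_def dest: spec[of _ 1])
  have "prime_semiring_ideal M"
    unfolding prime_semiring_ideal_def
  proof (intro conjI allI impI idM)
    show "M \<noteq> UNIV" using s_out by blast
  next
    fix a b assume ab: "a * b \<in> M"
    show "a \<in> M \<or> b \<in> M"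
    proof (rule ccontr)
      assume "\<not> (a \<in> M \<or> b \<in> M)"
      with capture obtain n x r m y t
        where n: "n > 0" "x \<in> M" "s ^ n = x + r * a" and m: "y \<in> M" "s ^ m = y + t * b"
        by metis
      have "s ^ (n + m) = x * (y + t * b) + (r * a) * y + (r * t) * (a * b)"
        using n m by (simp add: power_add algebra_simps)
      also have "\<dots> \<in> M"
        using n m ab idM
        by (intro semiring_ideal_add semiring_ideal_mult_left[of M y]
            semiring_ideal_mult_left[of M "a * b"] semiring_ideal_mult_right[of M x])
      finally have "s \<in> radical M"
        unfolding radical_def using n(1) by (intro CollectI exI[of _ "n + m"]) simp
      with sM show False by simp
    qed
  qed
  then show ?thesis using that IM s_out by blast
qed

lemma radical_eq_Inter_primes:
  assumes "semiring_ideal I"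
  shows "radical I = \<Inter>{P. prime_semiring_ideal P \<and> I \<subseteq> P}"
proof
  show "radical I \<subseteq> \<Inter>{P. prime_semiring_ideal P \<and> I \<subseteq> P}"
    using radical_mono radical_prime by blast
  show "\<Inter>{P. prime_semiring_ideal P \<and> I \<subseteq> P} \<subseteq> radical I"
    using prime_avoiding_powers[OF assms] by blast
qed

lemma radicals_subtractive_iff_primes_subtractive:
  "(\<forall>I::'a::comm_semiring_1 set. semiring_ideal I \<longrightarrow> subtractive_ideal (radical I)) \<longleftrightarrow>
   (\<forall>P::'a set. prime_semiring_ideal P \<longrightarrow> subtractive_ideal P)"
proof (intro iffI allI impI)
  fix P :: "'a set"
  assume "\<forall>I::'a set. semiring_ideal I \<longrightarrow> subtractive_ideal (radical I)"
    and "prime_semiring_ideal P"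
  then show "subtractive_ideal P" using radical_prime by (metis prime_semiring_ideal_def)
next
  fix I :: "'a set"
  assume "\<forall>P::'a set. prime_semiring_ideal P \<longrightarrow> subtractive_ideal P" and "semiring_ideal I"
  then show "subtractive_ideal (radical I)"
    unfolding radical_eq_Inter_primes[OF \<open>semiring_ideal I\<close>]
    by (intro subtractive_ideal_Inter) blast
qed

lemma hull_finite_subset_linear_combinations:
  assumes "finite F"
  shows "semiring_ideal hull F \<subseteq> range (\<lambda>s. \<Sum>c\<in>F. s c * c)" (is "_ \<subseteq> range ?L")
proof (rule hull_minimal)
  show "F \<subseteq> range ?L"
  proof
    fix x assume "x \<in> F"
    have "?L (\<lambda>c. if c = x then 1 else 0) = (\<Sum>c\<in>F. if c = x then x else 0)"
      by (intro sum.cong) auto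
    also have "\<dots> = x" using \<open>x \<in> F\<close> assms by simp
    finally show "x \<in> range ?L"
      by (intro range_eqI[of x ?L "\<lambda>c. if c = x then 1 else 0"]) (rule sym)
  qed
  show "semiring_ideal (range ?L)"
    unfolding semiring_ideal_def
  proof (intro conjI ballI allI)
    show "range ?L \<noteq> {}" by blast
  next
    fix u v assume "u \<in> range ?L" "v \<in> range ?L"
    then obtain s t where "u = ?L s" "v = ?L t" by blast
    then have "u + v = ?L (\<lambda>c. s c + t c)"
      by (simp add: sum.distrib distrib_right)
    then show "u + v \<in> range ?L" by (rule range_eqI[of _ ?L])
  next
    fix r u assume "u \<in> range ?L"
    then obtain s where "u = ?L s" by blast
    then have "r * u = ?L (\<lambda>c. r * s c)"
      by (simp add: sum_distrib_left mult.assoc)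
    then show "r * u \<in> range ?L" by (rule range_eqI[of _ ?L])
  qed
qed

section \<open>Coefficients and content of power series\<close>

lemma mfps_nth_zero: "mfps_nth 0 m = 0"
  by transfer simp

lemma mfps_nth_add: "mfps_nth (f + g) m = mfps_nth f m + mfps_nth g m"
  by transfer simp

lemma mfps_nth_mult:
  "mfps_nth (f * g) m = (\<Sum>(k, l)\<in>exponent_splits m. mfps_nth f k * mfps_nth g l)"
  by transfer simp

lemma mfps_nth_sum: "mfps_nth (sum f A) m = (\<Sum>x\<in>A. mfps_nth (f x) m)"
  by (induction A rule: infinite_finite_induct) (auto simp: mfps_nth_zero mfps_nth_add)

lemma mfps_nth_const: "mfps_nth (mfps_const c) m = (if m = (\<lambda>_. 0) then c else 0)"
  by transfer simp

lemma mfps_nth_const_mult: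
  fixes f :: "('a::comm_semiring_1, 'n::finite) mfps"
  shows "mfps_nth (mfps_const c * f) m = c * mfps_nth f m"
proof -
  have "(\<Sum>(k, l)\<in>exponent_splits m. mfps_nth (mfps_const c) k * mfps_nth f l)
      = (\<Sum>(k, l)\<in>{(\<lambda>_::'n. 0::nat, m)}. mfps_nth (mfps_const c) k * mfps_nth f l)"
    by (intro sum.mono_neutral_right finite_exponent_splits)
      (auto simp: exponent_splits_def fun_eq_iff mfps_nth_const split: if_splits)
  then show ?thesis by (simp add: mfps_nth_mult mfps_nth_const)
qed

lemma sum_mem_ideal_extension:
  assumes "finite A" "\<And>x. x \<in> A \<Longrightarrow> a x \<in> I"
  shows "(\<Sum>x\<in>A. h (a x) * f x) \<in> ideal_extension h I"
proof -
  obtain e where e: "bij_betw e {0..<card A} A"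
    using ex_bij_betw_nat_finite[OF assms(1)] by blast
  have "(\<Sum>x\<in>A. h (a x) * f x) = (\<Sum>i<card A. h (a (e i)) * f (e i))"
    using sum.reindex_bij_betw[OF e, of "\<lambda>x. h (a x) * f x"] by (simp add: lessThan_atLeast0)
  moreover have "\<forall>i<card A. a (e i) \<in> I"
    using bij_betwE[OF e] assms(2) by simp
  ultimately show ?thesis
    unfolding ideal_extension_def
    by (intro CollectI exI[of _ "card A"] exI[of _ "\<lambda>i. a (e i)"] exI[of _ "\<lambda>i. f (e i)"]) simp
qed

lemma mfps_nth_mem_if_ideal_extension:
  assumes "semiring_ideal I" "f \<in> ideal_extension mfps_const I"
  shows "mfps_nth f m \<in> I"
  using assms
  by (auto simp: ideal_extension_def mfps_nth_sum mfps_nth_const_mult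
      intro!: semiring_ideal_sum semiring_ideal_mult_right)

text \<open>The Noetherian hypothesis enters here: there may be infinitely many coefficients, and the
  ideal extension consists of finite sums.\<close>

lemma ideal_extension_mfps_iff:
  fixes f :: "('a::comm_semiring_1, 'n::finite) mfps"
  assumes "noetherian_semiring TYPE('a)" and I: "semiring_ideal I"
  shows "f \<in> ideal_extension mfps_const I \<longleftrightarrow> (\<forall>m. mfps_nth f m \<in> I)"
proof
  assume "f \<in> ideal_extension mfps_const I"
  then show "\<forall>m. mfps_nth f m \<in> I" using mfps_nth_mem_if_ideal_extension I by blast
next
  assume coeffs: "\<forall>m. mfps_nth f m \<in> I"
  obtain F where F: "finite F" "I = semiring_ideal hull F"
    using assms by (auto simp: noetherian_semiring_def)
  have "\<exists>s. mfps_nth f m = (\<Sum>c\<in>F. s c * c)" for m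
  proof -
    have "mfps_nth f m \<in> range (\<lambda>s. \<Sum>c\<in>F. s c * c)"
      using coeffs hull_finite_subset_linear_combinations[OF F(1)] F(2) by blast
    then show ?thesis by (rule rangeE) (rule exI)
  qed
  then obtain s where s: "\<And>m. mfps_nth f m = (\<Sum>c\<in>F. s m c * c)" by metis
  have "f = (\<Sum>c\<in>F. mfps_const c * Abs_mfps (\<lambda>m. s m c))"
    by (simp add: mfps_nth_inject[symmetric] fun_eq_iff mfps_nth_sum mfps_nth_const_mult s
        Abs_mfps_inverse mult.commute)
  moreover have "F \<subseteq> I" unfolding F(2) by (rule hull_subset)
  then have "(\<Sum>c\<in>F. mfps_const c * Abs_mfps (\<lambda>m. s m c)) \<in> ideal_extension mfps_const I"
    by (intro sum_mem_ideal_extension F(1)) blast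
  ultimately show "f \<in> ideal_extension mfps_const I" by simp
qed

lemma semiring_ideal_content: "semiring_ideal (content h f)"
  unfolding content_def by (rule semiring_ideal_Inter) blast

lemma mfps_nth_mem_content: "mfps_nth f m \<in> content mfps_const f"
  unfolding content_def using mfps_nth_mem_if_ideal_extension by blast

lemma content_mfps_subset_iff:
  fixes f :: "('a::comm_semiring_1, 'n::finite) mfps"
  assumes "noetherian_semiring TYPE('a)" "semiring_ideal I"
  shows "content mfps_const f \<subseteq> I \<longleftrightarrow> (\<forall>m. mfps_nth f m \<in> I)"
proof
  assume "\<forall>m. mfps_nth f m \<in> I"
  then show "content mfps_const f \<subseteq> I"
    using ideal_extension_mfps_iff[OF assms] assms(2) by (auto simp: content_def)
qed (use mfps_nth_mem_content in blast)

lemma content_semimodule_mfps: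
  assumes "noetherian_semiring TYPE('a::comm_semiring_1)"
  shows "content_semimodule (mfps_const :: 'a \<Rightarrow> ('a, 'n::finite) mfps)"
  unfolding content_semimodule_def
  by (simp add: ideal_extension_mfps_iff[OF assms semiring_ideal_content] mfps_nth_mem_content)

section \<open>Subtractive primes and Gauss's lemma\<close>

text \<open>In Gauss's argument this provides the exponents that leading monomials with respect to a
  monomial order would give, without constructing such an order.  Minimising one coordinate at a
  time, in \<open>A\<close> and in \<open>B\<close>, works because a sum of two minima can only be attained by both minima.\<close>

lemma exists_unique_decomposition_on:
  fixes A B :: "('n \<Rightarrow> nat) set"
  assumes "finite V" "A \<noteq> {}" "B \<noteq> {}"
  shows "\<exists>k\<in>A. \<exists>l\<in>B. \<forall>k'\<in>A. \<forall>l'\<in>B.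
           (\<forall>i. k' i + l' i = k i + l i) \<longrightarrow> (\<forall>i\<in>V. k' i = k i \<and> l' i = l i)"
  using assms
proof (induction V arbitrary: A B rule: finite_induct)
  case empty
  then obtain k l where "k \<in> A" "l \<in> B" by blast
  then show ?case by (intro bexI[of _ k] bexI[of _ l]) simp_all
next
  case (insert v V)
  define a where "a = (LEAST x. x \<in> (\<lambda>k. k v) ` A)"
  define b where "b = (LEAST x. x \<in> (\<lambda>l. l v) ` B)"
  define A' where "A' = {k \<in> A. k v = a}"
  define B' where "B' = {l \<in> B. l v = b}"
  have "a \<in> (\<lambda>k. k v) ` A"
    unfolding a_def using insert.prems by (intro LeastI_ex[of "\<lambda>x. x \<in> (\<lambda>k. k v) ` A"]) blast
  then have "A' \<noteq> {}" by (auto simp: A'_def)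
  have "b \<in> (\<lambda>l. l v) ` B"
    unfolding b_def using insert.prems by (intro LeastI_ex[of "\<lambda>x. x \<in> (\<lambda>l. l v) ` B"]) blast
  then have "B' \<noteq> {}" by (auto simp: B'_def)
  have a: "a \<le> k v" if "k \<in> A" for k
    unfolding a_def using that by (intro Least_le imageI)
  have b: "b \<le> l v" if "l \<in> B" for l
    unfolding b_def using that by (intro Least_le imageI)
  from insert.IH[OF \<open>A' \<noteq> {}\<close> \<open>B' \<noteq> {}\<close>] obtain k l where kl: "k \<in> A'" "l \<in> B'"
    and uniq: "\<And>k' l'. k' \<in> A' \<Longrightarrow> l' \<in> B' \<Longrightarrow> \<forall>i. k' i + l' i = k i + l i
                 \<Longrightarrow> \<forall>i\<in>V. k' i = k i \<and> l' i = l i"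
    by metis
  from kl have AB: "k \<in> A" "l \<in> B" and kl_v: "k v = a" "l v = b" by (simp_all add: A'_def B'_def)
  have "\<forall>i\<in>insert v V. k' i = k i \<and> l' i = l i"
    if "k' \<in> A" "l' \<in> B" and sum: "\<forall>i. k' i + l' i = k i + l i" for k' l'
  proof -
    have "k' v + l' v = a + b" using sum kl_v by simp
    with a[OF \<open>k' \<in> A\<close>] b[OF \<open>l' \<in> B\<close>] have v: "k' v = a" "l' v = b" by linarith+
    with \<open>k' \<in> A\<close> \<open>l' \<in> B\<close> have "k' \<in> A'" "l' \<in> B'" by (simp_all add: A'_def B'_def)
    from uniq[OF this sum] v kl_v show ?thesis by simp
  qed
  then show ?case by (intro bexI[OF _ AB(1)] bexI[OF _ AB(2)]) blast
qed

lemma coefficients_of_product_in_subtractive_prime: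
  fixes f g :: "('a::comm_semiring_1, 'n::finite) mfps"
  assumes P: "prime_semiring_ideal P" and sub: "subtractive_ideal P"
    and fg: "\<And>m. mfps_nth (f * g) m \<in> P"
  shows "(\<forall>m. mfps_nth f m \<in> P) \<or> (\<forall>m. mfps_nth g m \<in> P)"
proof (rule ccontr)
  assume "\<not> ?thesis"
  then have "{m. mfps_nth f m \<notin> P} \<noteq> {}" (is "?A \<noteq> {}")
    and "{m. mfps_nth g m \<notin> P} \<noteq> {}" (is "?B \<noteq> {}") by auto
  from exists_unique_decomposition_on[OF finite this, of UNIV]
  obtain k l where "k \<in> ?A" "l \<in> ?B"
    and decomp: "\<forall>k'\<in>?A. \<forall>l'\<in>?B.
      (\<forall>i. k' i + l' i = k i + l i) \<longrightarrow> (\<forall>i\<in>UNIV. k' i = k i \<and> l' i = l i)"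
    by (elim bexE) (rule that)
  then have k: "mfps_nth f k \<notin> P" and l: "mfps_nth g l \<notin> P" by simp_all
  have uniq: "k' = k \<and> l' = l"
    if "mfps_nth f k' \<notin> P" "mfps_nth g l' \<notin> P" "\<forall>i. k' i + l' i = k i + l i" for k' l'
  proof -
    have "\<forall>i\<in>UNIV. k' i = k i \<and> l' i = l i" using decomp that by blast
    then show ?thesis by (simp add: fun_eq_iff)
  qed
  have idP: "semiring_ideal P" using P by (simp add: prime_semiring_ideal_def)
  define E where "E = exponent_splits (\<lambda>i. k i + l i)"
  let ?t = "\<lambda>(k', l'). mfps_nth f k' * mfps_nth g l'"
  have rest: "sum ?t (E - {(k, l)}) \<in> P"
  proof (rule semiring_ideal_sum[OF idP])
    fix x assume x: "x \<in> E - {(k, l)}"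
    then obtain k' l' where x_eq: "x = (k', l')" by (cases x)
    with x uniq[of k' l'] have "mfps_nth f k' \<in> P \<or> mfps_nth g l' \<in> P"
      by (auto simp: E_def exponent_splits_def)
    then show "?t x \<in> P"
      using idP x_eq by (auto intro: semiring_ideal_mult_left semiring_ideal_mult_right)
  qed
  have "mfps_nth (f * g) (\<lambda>i. k i + l i) = sum ?t E" by (simp add: mfps_nth_mult E_def)
  also have "\<dots> = ?t (k, l) + sum ?t (E - {(k, l)})"
    by (rule sum.remove) (simp_all add: E_def, simp add: exponent_splits_def)
  finally have "sum ?t (E - {(k, l)}) + mfps_nth f k * mfps_nth g l \<in> P"
    using fg[of "\<lambda>i. k i + l i"] by (simp add: add.commute)
  with sub rest have "mfps_nth f k * mfps_nth g l \<in> P"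
    unfolding subtractive_ideal_def by blast
  with P k l show False by (auto simp: prime_semiring_ideal_def)
qed

lemma weak_content_if_primes_subtractive:
  assumes noeth: "noetherian_semiring TYPE('a::comm_semiring_1)"
    and sub: "\<And>P::'a set. prime_semiring_ideal P \<Longrightarrow> subtractive_ideal P"
  shows "weak_content_semialgebra (mfps_const :: 'a \<Rightarrow> ('a, 'n::finite) mfps)"
  unfolding weak_content_semialgebra_def
proof (intro conjI allI semialgebra_mfps_const content_semimodule_mfps[OF noeth])
  fix f g :: "('a, 'n) mfps"
  let ?c = "content (mfps_const :: 'a \<Rightarrow> ('a, 'n) mfps)"
  have "ideal_product (?c f) (?c g) \<subseteq> P"
    if P: "prime_semiring_ideal P" and fg: "?c (f * g) \<subseteq> P" for P
  proof -
    have idP: "semiring_ideal P" using P by (simp add: prime_semiring_ideal_def)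
    have "?c f \<subseteq> P \<or> ?c g \<subseteq> P"
      using coefficients_of_product_in_subtractive_prime[OF P sub[OF P], of f g] fg
      by (simp add: content_mfps_subset_iff[OF noeth idP])
    then have "a * b \<in> P" if "a \<in> ?c f" "b \<in> ?c g" for a b
      using that semiring_ideal_mult_left[OF idP] semiring_ideal_mult_right[OF idP] by blast
    then show ?thesis
      by (auto simp: ideal_product_def intro!: semiring_ideal_sum[OF idP])
  qed
  then show "ideal_product (?c f) (?c g) \<subseteq> radical (?c (f * g))"
    unfolding radical_eq_Inter_primes[OF semiring_ideal_content] by blast
qed

section \<open>Subtractivity from the weak content property\<close>

lemma primes_subtractive_if_weak_content:
  fixes P :: "'a::comm_semiring_1 set"
  assumes noeth: "noetherian_semiring TYPE('a)"
    and weak: "weak_content_semialgebra (mfps_const :: 'a \<Rightarrow> ('a, 'n::finite) mfps)"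
    and P: "prime_semiring_ideal P"
  shows "subtractive_ideal P"
proof -
  have idP: "semiring_ideal P" using P by (simp add: prime_semiring_ideal_def)
  let ?C = "mfps_const :: 'a \<Rightarrow> ('a, 'n) mfps"
  have hom: "?C (x + y) = ?C x + ?C y" "?C (x * y) = ?C x * ?C y" for x y
    using semialgebra_mfps_const[where 'a = 'a and 'n = 'n] by (auto simp: semialgebra_def)
  have "b \<in> P" if "a + b \<in> P" "a \<in> P" for a b
  proof -
    \<comment> \<open>Any non-constant monomial serves as the indeterminate; the product of all of them avoids
      singling one out.\<close>
    define e :: "'n \<Rightarrow> nat" where "e = (\<lambda>_. 1)"
    define X :: "('a, 'n) mfps" where "X = Abs_mfps (\<lambda>m. if m = e then 1 else 0)"
    define f where "f = ?C a + ?C b * X"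
    define g where "g = ?C b + ?C (a + b) * X"
    have X_nth: "mfps_nth X m = (if m = e then 1 else 0)" for m
      by (simp add: X_def Abs_mfps_inverse)
    have e0: "e \<noteq> (\<lambda>_. 0)" by (simp add: e_def fun_eq_iff)
    have "mfps_nth f e = b"
      using e0 by (simp add: f_def mfps_nth_add mfps_nth_const_mult mfps_nth_const X_nth)
    then have bf: "b \<in> content ?C f" by (metis mfps_nth_mem_content)
    have "mfps_nth g (\<lambda>_. 0) = b"
      using e0 by (simp add: g_def mfps_nth_add mfps_nth_const_mult mfps_nth_const X_nth)
    then have bg: "b \<in> content ?C g" by (metis mfps_nth_mem_content)
    have "f * g = ?C (a * b) * 1 + ?C (a * a + b * (a + b)) * X + ?C (b * (a + b)) * (X * X)"
      by (simp add: f_def g_def hom algebra_simps)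
    moreover have "a * b \<in> P" "a * a + b * (a + b) \<in> P" "b * (a + b) \<in> P"
      using that idP semiring_ideal_add semiring_ideal_mult_left semiring_ideal_mult_right
      by metis+
    ultimately have "\<forall>m. mfps_nth (f * g) m \<in> P"
      using idP by (simp only: mfps_nth_add mfps_nth_const_mult)
        (auto intro: semiring_ideal_add semiring_ideal_mult_right)
    then have "content ?C (f * g) \<subseteq> P"
      by (simp add: content_mfps_subset_iff[OF noeth idP])
    then have "radical (content ?C (f * g)) \<subseteq> P"
      using radical_mono radical_prime[OF P] by blast
    moreover have "b * b \<in> ideal_product (content ?C f) (content ?C g)"
      unfolding ideal_product_def
      by (rule CollectI, rule exI[of _ 1], rule exI[of _ "\<lambda>_. b"], rule exI[of _ "\<lambda>_. b"])
        (simp add: bf bg)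
    ultimately have "b * b \<in> P" using weak unfolding weak_content_semialgebra_def by blast
    then show "b \<in> P" using P by (auto simp: prime_semiring_ideal_def)
  qed
  with idP show ?thesis unfolding subtractive_ideal_def by blast
qed

theorem corollary46:
  assumes "noetherian_semiring TYPE('a::comm_semiring_1)"
  shows "(weak_content_semialgebra (mfps_const :: 'a \<Rightarrow> ('a, 'n::finite) mfps) \<longleftrightarrow>
            (\<forall>I::'a set. semiring_ideal I \<longrightarrow> subtractive_ideal (radical I)))
       \<and> ((\<forall>I::'a set. semiring_ideal I \<longrightarrow> subtractive_ideal (radical I)) \<longleftrightarrow>
            (\<forall>P::'a set. prime_semiring_ideal P \<longrightarrow> subtractive_ideal P))"
  using weak_content_if_primes_subtractive[OF assms, where 'n = 'n]
    primes_subtractive_if_weak_content[OF assms, where 'n = 'n]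
  unfolding radicals_subtractive_iff_primes_subtractive by blast

end
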